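(* Let $0<l_z<u_z<1$ and let $\mathcal F'=\{(x,y,z)\in\mathbb R^3 : z=xy,\ 0\le x\le 1,\ 0\le y\le 1,\ l_z\le z\le u_z\}$. Let $$M_1=\begin{pmatrix}u_z^2 & 2l_z-u_z\\ 2l_z-u_z & 1\end{pmatrix},\qquad M_2=\begin{pmatrix}1 & 2l_z-u_z\\ 2l_z-u_z & u_z^2\end{pmatrix}.$$ Then $M_1$ and $M_2$ are positive semidefinite, and $\operatorname{conv}(\mathcal F')$ is exactly the set of $(x,y,z)\in\mathbb R^3$ satisfying the RLT constraint $z\ge x+y-1$, the bounds $l_z\le z\le u_z$, and the following three second-order cone constraints, each imposed only when $(x,y)$ is in the indicated region: 1. if $y\ge u_zx$ and $x\ge u_zy$, then $(z+\sqrt{l_zu_z})^2\le(\sqrt{l_z}+\sqrt{u_z})^2\,xy$; 2. if $y\le u_zx$, then $\sqrt{(\hat x,\hat y)M_1(\hat x,\hat y)^T}\le u_zx+y-2z$, where $\hat x:=1-x$, $\hat y:=u_z-y$; 3. if $x\le u_zy$, then $\sqrt{(\hat x,\hat y)M_2(\hat x,\hat y)^T}\le x+u_zy-2z$, where $\hat x:=u_z-x$, $\hat y:=1-y$.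
   Context: $\operatorname{conv}$ denotes the convex hull in $\mathbb R^3$. "RLT" stands for Reformulation-Linearization Technique; the only RLT constraint used is written out in the claim. *)

theory Defs
  imports "HOL-Analysis.Analysis"
begin

definition pos_semidef :: "real^'n^'n \<Rightarrow> bool" where
  "pos_semidef A \<longleftrightarrow> transpose A = A \<and> (\<forall>v. 0 \<le> v \<bullet> (A *v v))"

definition F' :: "real \<Rightarrow> real \<Rightarrow> (real^3) set" where
  "F' l u = {vector [x, y, z] | x y z.
     z = x * y \<and> 0 \<le> x \<and> x \<le> 1 \<and> 0 \<le> y \<and> y \<le> 1 \<and> l \<le> z \<and> z \<le> u}"

definition M1 :: "real \<Rightarrow> real \<Rightarrow> real^2^2" where
  "M1 l u = vector [vector [u\<^sup>2, 2 * l - u], vector [2 * l - u, 1]]"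

definition M2 :: "real \<Rightarrow> real \<Rightarrow> real^2^2" where
  "M2 l u = vector [vector [1, 2 * l - u], vector [2 * l - u, u\<^sup>2]]"

end

theory Submission
  imports Defs
begin

text \<open>
  The region \<open>y \<le> u x\<close> (and symmetrically \<open>x \<le> u y\<close>) is handled by projecting from the point \<open>(1, u, u)\<close>:
  the second-order cone there has this apex, and its section at \<open>z = l\<close> is bounded by the hyperbola
  \<open>x y = l\<close>. In the middle region the cone has apex \<open>(0, 0, - sqrt (l u))\<close> and its sections at
  \<open>z = l\<close> and \<open>z = u\<close> are bounded by \<open>x y = l\<close> and \<open>x y = u\<close>. So each point satisfying the
  constraints is a convex combination of points of \<open>F'\<close> found along rays from these apices and
  on the face \<open>z = x + y - 1\<close>. Conversely, a cone constraint holds on the hull because each of its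
  relevant tangent planes is a valid linear inequality on \<open>F'\<close>; in the
  region \<open>y \<le> u x\<close> only the tangent planes touching the cone inside that region are valid.
\<close>

section \<open>Quadratic forms of \<open>M1\<close> and \<open>M2\<close> and their
  semidefiniteness\<close>

lemma vector3_eta: "(vector [v$1, v$2, v$3] :: real^3) = v"
  by (simp add: vec_eq_iff forall_3)

text \<open>The off-diagonal entry is \<open>u - 2*(u - l)\<close>, which splits off a perfect
  square; on the cone this exposes a difference of squares.\<close>

lemma quadform_M1:
  "(vector [a, b] :: real^2) \<bullet> (M1 l u *v vector [a, b]) = (u*a + b)\<^sup>2 - 4*(u - l)*(a*b)"
  by (simp add: M1_def inner_vec_def matrix_vector_mult_def sum_2 power2_eq_square algebra_simps)

lemma quadform_M2:
  "(vector [a, b] :: real^2) \<bullet> (M2 l u *v vector [a, b]) = (u*b + a)\<^sup>2 - 4*(u - l)*(b*a)"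
  by (simp add: M2_def inner_vec_def matrix_vector_mult_def sum_2 power2_eq_square algebra_simps)

text \<open>The form also equals \<open>(u*a - b)\<^sup>2 + 4*(l*(a*b))\<close>; for each sign of
  \<open>a*b\<close> one of the two shapes is visibly nonnegative.\<close>

lemma quadform_nonneg:
  fixes l u a b :: real
  assumes "0 < l" "l < u"
  shows "0 \<le> (u*a + b)\<^sup>2 - 4*(u - l)*(a*b)"
proof (cases "a*b \<le> 0")
  case True
  then have "(u - l)*(a*b) \<le> 0"
    using assms by (simp add: mult_nonneg_nonpos)
  then show ?thesis
    using zero_le_power2[of "u*a + b"] by linarith
next
  case False
  have "(u*a + b)\<^sup>2 - 4*(u - l)*(a*b) = (u*a - b)\<^sup>2 + 4*(l*(a*b))"
    by (simp add: power2_eq_square algebra_simps)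
  then show ?thesis
    using False assms by simp
qed

lemma vector2_eta: "(vector [v$1, v$2] :: real^2) = v"
  by (simp add: vec_eq_iff forall_2)

lemma pos_semidef_M1:
  assumes "0 < l" "l < u"
  shows "pos_semidef (M1 l u)"
proof -
  have "transpose (M1 l u) = M1 l u"
    by (simp add: vec_eq_iff forall_2 transpose_def M1_def)
  moreover have "0 \<le> v \<bullet> (M1 l u *v v)" for v
    using quadform_nonneg[OF assms] quadform_M1[of "v$1" "v$2" l u] by (simp add: vector2_eta)
  ultimately show ?thesis
    by (simp add: pos_semidef_def)
qed

lemma pos_semidef_M2:
  assumes "0 < l" "l < u"
  shows "pos_semidef (M2 l u)"
proof -
  have "transpose (M2 l u) = M2 l u"
    by (simp add: vec_eq_iff forall_2 transpose_def M2_def)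
  moreover have "0 \<le> v \<bullet> (M2 l u *v v)" for v
    using quadform_nonneg[OF assms] quadform_M2[of "v$1" "v$2" l u] by (simp add: vector2_eta)
  ultimately show ?thesis
    by (simp add: pos_semidef_def)
qed

section \<open>Arithmetic and geometric means\<close>

lemma weighted_AM_GM:
  fixes x y p :: real
  assumes "0 \<le> x" "0 \<le> y" "0 < p"
  shows "2 * sqrt (x*y) \<le> p*x + y/p"
proof -
  have "0 \<le> (sqrt (p*x) - sqrt (y/p))\<^sup>2"
    by simp
  also have "\<dots> = p*x + y/p - 2 * sqrt ((p*x) * (y/p))"
    using assms by (simp add: power2_diff del: real_sqrt_mult flip: real_sqrt_mult)
  also have "(p*x) * (y/p) = x*y"
    using assms by simp
  finally show ?thesis by simp
qed

lemma AM_GM_product: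
  fixes a b c :: real
  assumes "0 \<le> a" "0 \<le> b" "0 \<le> c" "c\<^sup>2 \<le> a*b"
  shows "2*c \<le> a + b"
proof -
  have "c \<le> sqrt (a*b)"
    using assms by (intro real_le_rsqrt)
  then show ?thesis
    using weighted_AM_GM[of a b 1] assms by simp
qed

section \<open>Valid inequalities, symmetry and convex combinations on the hull\<close>

lemma hull_halfspace:
  assumes "vector [x, y, z] \<in> convex hull (F' l u)"
    and "\<And>x y. \<lbrakk>0 \<le> x; x \<le> 1; 0 \<le> y; y \<le> 1; l \<le> x*y; x*y \<le> u\<rbrakk>
      \<Longrightarrow> D \<le> A*x + B*y + C*(x*y)"
  shows "D \<le> A*x + B*y + C*z"
proof -
  let ?H = "{v :: real^3. vector [A, B, C] \<bullet> v \<ge> D}"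
  have "F' l u \<subseteq> ?H"
    using assms(2) by (auto simp: F'_def inner_vec_def sum_3)
  then have "convex hull (F' l u) \<subseteq> ?H"
    by (intro hull_minimal convex_halfspace_ge)
  then show ?thesis
    using assms(1) by (auto simp: inner_vec_def sum_3)
qed

text \<open>Exchanging the first two coordinates is linear and preserves \<open>F'\<close>; this
  reduces the region \<open>x \<le> u*y\<close> to \<open>y \<le> u*x\<close>.\<close>

lemma hull_swap:
  assumes "vector [x, y, z] \<in> convex hull (F' l u)"
  shows "vector [y, x, z] \<in> convex hull (F' l u)"
proof -
  let ?s = "\<lambda>v :: real^3. vector [v$2, v$1, v$3] :: real^3"
  have lin: "linear ?s"
    by (rule linearI) (simp_all add: vec_eq_iff forall_3)
  have "vector [y, x, z] = ?s (vector [x, y, z])"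
    by simp
  also have "\<dots> \<in> ?s ` (convex hull (F' l u))"
    using assms by blast
  also have "\<dots> = convex hull (?s ` F' l u)"
    by (rule convex_hull_linear_image[OF lin])
  also have "?s ` F' l u \<subseteq> F' l u"
    by (clarsimp simp: F'_def) (metis mult.commute)
  then have "convex hull (?s ` F' l u) \<subseteq> convex hull (F' l u)"
    by (rule hull_mono)
  finally show ?thesis .
qed

lemma hull_on_surface:
  assumes "0 \<le> x" "x \<le> 1" "0 \<le> y" "y \<le> 1" "l \<le> z" "z \<le> u" "x*y = z"
  shows "vector [x, y, z] \<in> convex hull (F' l u)"
  using assms by (intro hull_inc) (auto simp: F'_def)

lemma hull_convex_comb:
  assumes "vector [x, y, z] \<in> convex hull (F' l u)"
    and "vector [x', y', z'] \<in> convex hull (F' l u)"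
    and "0 \<le> t" "t \<le> 1"
    and "X = (1 - t)*x + t*x'" "Y = (1 - t)*y + t*y'" "Z = (1 - t)*z + t*z'"
  shows "vector [X, Y, Z] \<in> convex hull (F' l u)"
proof -
  have "(vector [X, Y, Z] :: real^3) = (1 - t) *\<^sub>R vector [x, y, z] + t *\<^sub>R vector [x', y', z']"
    using assms by (simp add: vec_eq_iff forall_3)
  also have "\<dots> \<in> convex hull (F' l u)"
    using assms by (intro convexD[OF convex_convex_hull]) auto
  finally show ?thesis .
qed

section \<open>Points of the hull in the middle region\<close>

lemma hull_RLT_face:
  assumes "0 < l" "u < 1" "l \<le> z" "z \<le> u" "x \<le> 1" "y \<le> 1" "x + y = 1 + z"
  shows "vector [x, y, z] \<in> convex hull (F' l u)"
proof (rule hull_convex_comb)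
  show "vector [1, z, z] \<in> convex hull (F' l u)" "vector [z, 1, z] \<in> convex hull (F' l u)"
    using assms by (auto intro!: hull_on_surface)
  define t where "t = (1 - x)/(1 - z)"
  have t: "t*(1 - z) = 1 - x"
    using assms by (simp add: t_def)
  show "0 \<le> t" "t \<le> 1"
    using assms by (auto simp: t_def field_simps)
  show "x = (1 - t)*1 + t*z" "y = (1 - t)*z + t*1" "z = (1 - t)*z + t*z"
    using t assms(7) by (simp_all add: algebra_simps)
qed

text \<open>On the horizontal ray, the point lies between the given one at factor \<open>m\<close>
  and the RLT face at factor \<open>n\<close>; \<open>z*x \<le> y\<close> and
  \<open>z*y \<le> x\<close> keep the outer end in the unit square.\<close>

lemma hull_along_ray:
  assumes "0 < l" "u < 1" "l \<le> z" "z \<le> u" "0 < x" "0 < y"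
    and "z*x \<le> y" "z*y \<le> x" "x + y \<le> 1 + z"
    and "m \<le> 1" and m: "vector [m*x, m*y, z] \<in> convex hull (F' l u)"
  shows "vector [x, y, z] \<in> convex hull (F' l u)"
proof -
  define n where "n = (1 + z)/(x + y)"
  have n: "1 \<le> n" "n*x + n*y = 1 + z"
    using assms by (simp_all add: n_def flip: add_divide_distrib distrib_left)
  have "(1 + z)*x \<le> x + y" "(1 + z)*y \<le> x + y"
    using assms by (simp_all add: distrib_right)
  then have "n*x \<le> 1" "n*y \<le> 1"
    using assms by (simp_all add: n_def)
  then have nP: "vector [n*x, n*y, z] \<in> convex hull (F' l u)"
    using assms n by (intro hull_RLT_face) auto
  show ?thesis
  proof (cases "m = 1")
    case True
    then show ?thesis using m by simp
  next
    case False
    define t where "t = (1 - m)/(n - m)"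
    have "m < n" using False n assms by simp
    then have t: "0 \<le> t" "t \<le> 1" "t*(n - m) = 1 - m"
      using assms n by (simp_all add: t_def)
    then have "(1 - t)*m + t*n = 1"
      by (simp add: algebra_simps)
    then have "x = ((1 - t)*m + t*n)*x" "y = ((1 - t)*m + t*n)*y"
      by simp_all
    then show ?thesis
      by (intro hull_convex_comb[OF m nP t(1,2)]) (simp_all add: algebra_simps)
  qed
qed

lemma hull_middle_region:
  assumes "0 < l" "l < u" "u < 1" "l \<le> z" "z \<le> u" "0 < x" "0 < y"
    and "u*x \<le> y" "u*y \<le> x" "x + y \<le> 1 + z"
    and cone: "(z + sqrt (l*u))\<^sup>2 \<le> (sqrt l + sqrt u)\<^sup>2 * (x*y)"
  shows "vector [x, y, z] \<in> convex hull (F' l u)"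
proof -
  define r where "r = sqrt (x*y)"
  define c where "c = sqrt l + sqrt u"
  \<comment> \<open>At factor \<open>m\<close> along the ray the cone constraint is tight, so the
    constraint amounts to \<open>m \<le> 1\<close>.\<close>
  define m where "m = (z + sqrt (l*u)) / (c*r)"
  have pos: "0 < r" "0 < c"
    using assms by (auto simp: r_def c_def add_pos_pos)
  have r2: "r*r = x*y"
    using assms by (simp add: r_def)
  have "(z + sqrt (l*u))\<^sup>2 \<le> (c*r)\<^sup>2"
    using cone assms by (simp add: c_def r_def power_mult_distrib)
  then have "z + sqrt (l*u) \<le> c*r"
    by (rule power2_le_imp_le) (use pos in auto)
  then have m1: "m \<le> 1"
    using pos by (simp add: m_def)
  have level_point: "vector [sqrt k * x/r, sqrt k * y/r, k] \<in> convex hull (F' l u)"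
    if "l \<le> k" "k \<le> u" for k
  proof (rule hull_on_surface)
    have "k*x \<le> y" "k*y \<le> x"
      using that assms mult_right_mono[of k u x] mult_right_mono[of k u y] by linarith+
    then have "k*x*x \<le> y*x" "k*y*y \<le> x*y"
      using assms by simp_all
    then have "(sqrt k * x)\<^sup>2 \<le> r\<^sup>2" "(sqrt k * y)\<^sup>2 \<le> r\<^sup>2"
      using that assms r2 by (simp_all add: power_mult_distrib) (simp_all add: power2_eq_square ac_simps)
    then have "sqrt k * x \<le> r" "sqrt k * y \<le> r"
      using pos by (meson power2_le_imp_le less_imp_le)+
    then show "sqrt k * x/r \<le> 1" "sqrt k * y/r \<le> 1"
      using pos by simp_all
    have "sqrt k * x/r * (sqrt k * y/r) = (sqrt k * sqrt k) * (x*y) / (r*r)"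
      by simp
    then show "sqrt k * x/r * (sqrt k * y/r) = k"
      using that assms pos(1) by (simp flip: r2)
  qed (use that assms pos in auto)
  define t where "t = (z - l)/(u - l)"
  have t01: "0 \<le> t" "t \<le> 1" and "t*(u - l) = z - l"
    using assms by (simp_all add: t_def)
  then have tz: "z = (1 - t)*l + t*u"
    by (simp add: algebra_simps)
  \<comment> \<open>\<open>sqrt k = (k + sqrt (l*u))/c\<close> holds at \<open>k = l\<close> and
    \<open>k = u\<close>, and its right side is affine in \<open>k\<close>.\<close>
  have "(1 - t) * sqrt l + t * sqrt u = (z + sqrt (l*u))/c"
  proof -
    have sq: "sqrt l * sqrt l = l" "sqrt u * sqrt u = u" "sqrt (l*u) = sqrt l * sqrt u"
      using assms by (simp_all add: real_sqrt_mult)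
    have "((1 - t) * sqrt l + t * sqrt u) * c
        = (1 - t)*(sqrt l * sqrt l) + t*(sqrt u * sqrt u) + sqrt l * sqrt u"
      by (simp add: c_def algebra_simps)
    also have "\<dots> = z + sqrt (l*u)"
      using tz by (simp only: sq)
    finally show ?thesis
      using pos by (simp add: field_simps)
  qed
  then have "m = ((1 - t) * sqrt l + t * sqrt u)/r"
    by (simp add: m_def)
  then have m_eq: "m = (1 - t)*(sqrt l / r) + t*(sqrt u / r)"
    by (simp add: add_divide_distrib)
  have "vector [m*x, m*y, z] \<in> convex hull (F' l u)"
    by (rule hull_convex_comb[OF level_point[of l] level_point[of u] t01])
      (use assms(2) in \<open>simp_all add: m_eq tz distrib_right\<close>)
  moreover have "z*x \<le> y" "z*y \<le> x"
    using assms mult_right_mono[of z u x] mult_right_mono[of z u y] by linarith+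
  ultimately show ?thesis
    using hull_along_ray[of l u z x y m] assms m1 by simp
qed

section \<open>Points of the hull in the corner region \<open>y \<le> u*x\<close>\<close>

text \<open>The hyperbola and the line \<open>x + y = 1 + l\<close> bound this section; shrinking
  towards the origin reaches the hyperbola inside the unit square.\<close>

lemma hull_bottom_section:
  assumes "0 < l" "l < u" "u < 1" "0 < x" "0 < y" "l \<le> x*y" "x + y \<le> 1 + l"
  shows "vector [x, y, l] \<in> convex hull (F' l u)"
proof -
  \<comment> \<open>The line \<open>p + q = 1 + l\<close> meets the hyperbola \<open>p*q = l\<close>
    at \<open>p = 1\<close> and \<open>p = l\<close>.\<close>
  have box: "p \<le> 1 \<and> l \<le> p" if "0 < p" "0 < q" "l \<le> p*q" "p + q \<le> 1 + l" for p q :: real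
  proof -
    have "p*q \<le> p*(1 + l - p)"
      using that by (intro mult_left_mono) auto
    then have "(p - 1)*(p - l) \<le> 0"
      using that by (simp add: algebra_simps)
    then show ?thesis
      using assms unfolding mult_le_0_iff by linarith
  qed
  have b: "x \<le> 1" "l \<le> x" "y \<le> 1" "l \<le> y"
    using box[of x y] box[of y x] assms by (auto simp: mult.commute)
  then have "l*x \<le> l*1" "l*y \<le> l*1"
    using assms by simp_all
  then have ray: "l*x \<le> y" "l*y \<le> x"
    using b by linarith+
  define r where "r = sqrt (x*y)"
  have r: "0 < r" "r*r = x*y"
    using assms by (auto simp: r_def)
  have sl: "sqrt l * sqrt l = l"
    using assms by simp
  define m where "m = sqrt l / r"
  have m1: "m \<le> 1"
    using assms r by (simp add: m_def r_def)
  have m2: "m*m*(x*y) = l"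
    using r(1) sl by (simp add: m_def flip: r(2))
  have m0: "0 \<le> m"
    using assms r by (simp add: m_def)
  have "(m*x)\<^sup>2 \<le> 1" "(m*y)\<^sup>2 \<le> 1"
  proof -
    have "(m*x)\<^sup>2 * y = m*m*(x*y)*x" "(m*y)\<^sup>2 * x = m*m*(x*y)*y"
      by (simp_all add: power2_eq_square)
    then have "(m*x)\<^sup>2 * y \<le> 1*y" "(m*y)\<^sup>2 * x \<le> 1*x"
      using ray m2 by simp_all
    then show "(m*x)\<^sup>2 \<le> 1" "(m*y)\<^sup>2 \<le> 1"
      using assms by (auto simp only: mult_le_cancel_right_pos)
  qed
  then have "m*x \<le> 1" "m*y \<le> 1"
    by (simp_all only: abs_square_le_1 abs_le_iff)
  then have "vector [m*x, m*y, l] \<in> convex hull (F' l u)"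
    using m0 m2 assms by (intro hull_on_surface) (auto simp: algebra_simps)
  then show ?thesis
    using hull_along_ray[of l u l x y m] assms m1 ray by simp
qed

text \<open>
  Here \<open>(X, Y, l)\<close> is the point of the plane \<open>z = l\<close> on the ray from \<open>(1, u, u)\<close> through \<open>(x, y, z)\<close>.
\<close>
lemma apex_projection:
  fixes l u t X Y x y z :: real
  assumes "x = 1 - t*(1 - X)" "y = u - t*(u - Y)" "z = u - t*(u - l)"
  shows "(u*(1 - x) + (u - y))\<^sup>2 - 4*(u - l)*((1 - x)*(u - y))
      = (u*x + y - 2*z)\<^sup>2 - 4*(t\<^sup>2*(u - l)*(X*Y - l))"
    and "u*x + y - 2*z = t*(u*X + Y - 2*l)"
    and "u*x - y = t*(u*X - Y)"
    and "z + 1 - x - y = t*(1 + l - X - Y)"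
  unfolding assms by (simp_all add: power2_eq_square algebra_simps)

text \<open>The height fixes \<open>t\<close>; \<open>z < u\<close> makes it nonzero, since a
  horizontal line through the apex never meets the plane \<open>z = l\<close>.\<close>

lemma apex_projection_exists:
  fixes l u x y z :: real
  assumes "l < u" "l \<le> z" "z < u"
  obtains t X Y where "0 < t" "t \<le> 1"
    "x = 1 - t*(1 - X)" "y = u - t*(u - Y)" "z = u - t*(u - l)"
proof
  let ?t = "(u - z)/(u - l)"
  show "0 < ?t" "?t \<le> 1" "z = u - ?t*(u - l)"
    using assms by auto
  show "x = 1 - ?t*(1 - (1 - (1 - x)/?t))" "y = u - ?t*(u - (u - (u - y)/?t))"
    using assms by auto
qed

text \<open>Projection from the apex turns the squared cone constraint into
  \<open>l \<le> X*Y\<close>, so the point lies between the apex and a hull point at height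
  \<open>l\<close>.\<close>

lemma hull_corner_region:
  assumes "0 < l" "l < u" "u < 1" "l \<le> z" "z \<le> u" "x + y - 1 \<le> z" "y \<le> u*x"
    and cone: "sqrt ((u*(1 - x) + (u - y))\<^sup>2 - 4*(u - l)*((1 - x)*(u - y))) \<le> u*x + y - 2*z"
  shows "vector [x, y, z] \<in> convex hull (F' l u)"
proof -
  let ?q = "(u*(1 - x) + (u - y))\<^sup>2 - 4*(u - l)*((1 - x)*(u - y))"
  have q0: "0 \<le> ?q"
    by (rule quadform_nonneg) fact+
  have cone0: "0 \<le> u*x + y - 2*z"
    using cone real_sqrt_ge_zero[OF q0] by linarith
  have cone2: "?q \<le> (u*x + y - 2*z)\<^sup>2"
    using cone q0 by (meson sqrt_le_D)
  have apex: "vector [1, u, u] \<in> convex hull (F' l u)"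
    using assms by (intro hull_on_surface) auto
  show ?thesis
  proof (cases "z = u")
    case True
    \<comment> \<open>At apex height, \<open>2*u \<le> u*x + y\<close>, \<open>y \<le> u*x\<close>
      and \<open>x + y \<le> 1 + u\<close> leave only the apex.\<close>
    have "u*1 \<le> u*x"
      using cone0 assms True by linarith
    then have "1 \<le> x"
      using assms by simp
    moreover have "(1 - u)*(x - 1) \<le> 0"
      using cone0 assms True by (simp add: algebra_simps)
    then have "x \<le> 1"
      using assms by (simp add: mult_le_0_iff)
    ultimately have "x = 1"
      by simp
    then have "y = u"
      using cone0 assms True by simp
    then show ?thesis
      using apex True \<open>x = 1\<close> by simp
  next
    case False
    then obtain t X Y where t: "0 < t" "t \<le> 1"
      and eq: "x = 1 - t*(1 - X)" "y = u - t*(u - Y)" "z = u - t*(u - l)"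
      using apex_projection_exists assms by (metis less_eq_real_def)
    note proj = apex_projection[OF eq]
    have "0 \<le> t\<^sup>2*(u - l)*(X*Y - l)"
      using cone2 unfolding proj(1) by linarith
    moreover have "0 < t\<^sup>2*(u - l)"
      using t assms by simp
    ultimately have XY: "l \<le> X*Y"
      by (simp add: zero_le_mult_iff)
    have sum: "2*l \<le> u*X + Y"
      using cone0 t unfolding proj(2) by (simp add: zero_le_mult_iff)
    have "X + Y \<le> 1 + l"
    proof -
      have "0 \<le> t*(1 + l - X - Y)"
        using assms by (simp flip: proj(4))
      then show ?thesis
        using t by (simp add: zero_le_mult_iff)
    qed
    \<comment> \<open>\<open>l \<le> X*Y\<close> allows both branches of the hyperbola;
      \<open>2*l \<le> u*X + Y\<close> excludes the negative one.\<close>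
    moreover have "0 < X \<and> 0 < Y"
    proof (rule ccontr)
      assume "\<not> ?thesis"
      moreover have "0 < X*Y"
        using XY assms by linarith
      ultimately have "X < 0" "Y < 0"
        by (auto simp: zero_less_mult_iff)
      then have "u*X + Y < 0"
        using assms by (simp add: add_neg_neg mult_pos_neg)
      then show False
        using sum assms by linarith
    qed
    ultimately have "vector [X, Y, l] \<in> convex hull (F' l u)"
      using XY assms by (intro hull_bottom_section) auto
    then show ?thesis
      by (rule hull_convex_comb[OF apex _ less_imp_le[OF t(1)] t(2)])
        (simp_all add: eq algebra_simps)
  qed
qed

section \<open>Validity of the corner cone on the hull\<close>

text \<open>
  The plane through \<open>(1, u, u)\<close> tangent at \<open>(p, q, l)\<close> to the hyperbola \<open>x y = l\<close>. For fixed \<open>x\<close> the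
  claim is affine in \<open>y\<close>, so it suffices to check it at \<open>x y = l\<close> and at \<open>x y = u\<close>.
\<close>
lemma tangent_plane_valid:
  fixes l u x y p q :: real
  assumes "0 < l" "l < u" "0 \<le> x" "x \<le> 1" "l \<le> x*y" "x*y \<le> u"
    and "0 < p" "0 < q" "p*q = l" "q \<le> u*p"
  shows "2*l*(u - x*y) + (x*y - l)*(q + u*p) \<le> (u - l)*(q*x + p*y)"
proof -
  have x: "0 < x"
    using assms by (cases "x = 0") auto
  have bottom: "2*l \<le> q*x + p*l/x"
    by (rule AM_GM_product) (use assms x in \<open>auto simp: power2_eq_square\<close>)
  have "q*x \<le> q*1"
    using assms by simp
  then have "q*x \<le> u*p"
    using assms by linarith
  \<comment> \<open>At \<open>x*y = u\<close> the slack factors, and \<open>q \<le> u*p\<close> with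
    \<open>x \<le> 1\<close> makes both factors nonnegative. This is where the tangency point must
    lie in the region.\<close>
  then have "0 \<le> (1 - x)*(u*p - q*x)/x"
    using assms x by simp
  also have "\<dots> = q*x + p*u/x - (q + u*p)"
    using x by (simp add: field_simps)
  finally have top: "q + u*p \<le> q*x + p*u/x"
    by simp
  have "(u - x*y)*(2*l) + (x*y - l)*(q + u*p)
      \<le> (u - x*y)*(q*x + p*l/x) + (x*y - l)*(q*x + p*u/x)"
    using assms by (intro add_mono mult_left_mono bottom top) simp_all
  also have "\<dots> = (u - l)*(q*x + p*y)"
    using x by (simp add: field_simps)
  finally show ?thesis
    by (simp add: algebra_simps)
qed

text \<open>The decisive tangent is the one at the point of the hyperbola on the ray through
  \<open>(X, Y)\<close>; the other hypotheses make it one of the available tangents.\<close>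

lemma tangent_lines_imp_hyperbola:
  fixes l u X Y :: real
  assumes "0 < l" "l < u" "u < 1" "Y \<le> u*X" "X + Y \<le> 1 + l"
    and tangent: "\<And>p q. \<lbrakk>0 < p; p \<le> 1; 0 < q; p*q = l; q \<le> u*p\<rbrakk> \<Longrightarrow> 2*l \<le> q*X + p*Y"
  shows "l \<le> X*Y \<and> 2*l \<le> u*X + Y"
proof -
  \<comment> \<open>With \<open>Y \<le> u*X\<close> and \<open>X + Y \<le> 1 + l\<close>, the
    tangent at \<open>(1, l)\<close> forces \<open>0 < X\<close> and
    \<open>l*X \<le> Y\<close>.\<close>
  have tan1: "2*l \<le> l*X + Y"
    using tangent[of 1 l] assms by simp
  have "0 < X"
  proof (rule ccontr)
    assume "\<not> 0 < X"
    then have "l*X \<le> 0" "u*X \<le> 0"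
      using assms by (auto simp: mult_nonneg_nonpos)
    then show False
      using tan1 assms by linarith
  qed
  have YX: "l*X \<le> Y"
  proof (rule ccontr)
    assume "\<not> ?thesis"
    then have "l*1 < l*X"
      using tan1 by linarith
    then have "1 < X"
      using assms by simp
    then have "(1 - l)*1 < (1 - l)*X"
      using assms by (intro mult_strict_left_mono) auto
    then show False
      using tan1 assms by (simp add: algebra_simps)
  qed
  then have "0 < Y"
    using \<open>0 < X\<close> assms by (meson less_le_trans mult_pos_pos)
  define r where "r = sqrt (X*Y)"
  have r: "0 < r" "r*r = X*Y"
    using \<open>0 < X\<close> \<open>0 < Y\<close> by (auto simp: r_def)
  \<comment> \<open>\<open>(p, q)\<close> is \<open>(X, Y)\<close> scaled onto the hyperbola;
    \<open>l*X \<le> Y\<close> gives \<open>p \<le> 1\<close>, and \<open>Y \<le> u*X\<close> gives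
    \<open>q \<le> u*p\<close>.\<close>
  define p where "p = sqrt l * X / r"
  define q where "q = sqrt l * Y / r"
  have sl: "sqrt l * sqrt l = l" "0 < sqrt l"
    using assms by simp_all
  have "2*l \<le> q*X + p*Y"
  proof (rule tangent)
    show "0 < p" "0 < q"
      using \<open>0 < X\<close> \<open>0 < Y\<close> r sl by (simp_all add: p_def q_def)
    have "(sqrt l * X)\<^sup>2 = l*X*X"
      using assms by (simp add: power_mult_distrib power2_eq_square)
    also have "\<dots> \<le> Y*X"
      using YX \<open>0 < X\<close> by simp
    finally have "(sqrt l * X)\<^sup>2 \<le> r\<^sup>2"
      using r(2) by (simp add: power2_eq_square[of r] mult.commute)
    then have "sqrt l * X \<le> r"
      using r(1) by (meson power2_le_imp_le less_imp_le)
    then show "p \<le> 1"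
      using r by (simp add: p_def)
    have "p*q = (sqrt l * sqrt l) * (X*Y) / (r*r)"
      by (simp add: p_def q_def)
    then show "p*q = l"
      using r(1) unfolding sl(1) r(2)[symmetric] by simp
    have "sqrt l / r * Y \<le> sqrt l / r * (u*X)"
      using assms r by (intro mult_left_mono) auto
    then show "q \<le> u*p"
      by (simp add: p_def q_def mult.commute mult.left_commute)
  qed
  also have "q*X + p*Y = 2 * sqrt l * (X*Y) / r"
    by (simp add: p_def q_def algebra_simps)
  also have "\<dots> = 2 * sqrt l * r"
    using r(1) by (simp flip: r(2))
  finally have "sqrt l * sqrt l \<le> sqrt l * r"
    unfolding sl by simp
  then have "l \<le> X*Y"
    using sl(2) unfolding mult_le_cancel_left_pos[OF sl(2)] by (simp add: r_def)
  moreover have "2*l \<le> u*X + Y"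
    using tan1 mult_right_mono[of l u X] \<open>0 < X\<close> assms by linarith
  ultimately show ?thesis ..
qed

text \<open>The planes pass through the apex, so below it their slack scales with \<open>t\<close>
  and the claim reduces to tangent lines at height \<open>l\<close>.\<close>

lemma corner_cone_of_tangent_planes:
  fixes l u x y z :: real
  assumes "0 < l" "l < u" "u < 1" "l \<le> z" "z \<le> u" "x + y - 1 \<le> z" "y \<le> u*x"
    and tangent: "\<And>p q. \<lbrakk>0 < p; p \<le> 1; 0 < q; p*q = l; q \<le> u*p\<rbrakk>
      \<Longrightarrow> 2*l*(u - z) + (z - l)*(q + u*p) \<le> (u - l)*(q*x + p*y)"
  shows "sqrt ((u*(1 - x) + (u - y))\<^sup>2 - 4*(u - l)*((1 - x)*(u - y))) \<le> u*x + y - 2*z"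
proof (cases "z = u")
  case True
  have tan: "q + u*p \<le> q*x + p*y" if "0 < p" "p \<le> 1" "0 < q" "p*q = l" "q \<le> u*p" for p q
    using tangent[OF that] assms True by simp
  have "l + u \<le> l*x + y"
    using tan[of 1 l] assms by simp
  then have "(1 - l)*x \<le> (1 - l)*1"
    using assms True by (simp add: algebra_simps)
  then have x1: "x \<le> 1"
    using assms by simp
  \<comment> \<open>The tangent at \<open>(p, u*p)\<close>, on the boundary \<open>y = u*x\<close>
    of the region, gives \<open>2*u \<le> u*x + y\<close>; with \<open>x \<le> 1\<close> only the
    apex remains.\<close>
  define p where "p = sqrt (l/u)"
  have p: "0 < p" "p \<le> 1"
    using assms by (auto simp: p_def)
  have "p*(u*p) = u*(p*p)"
    by simp
  also have "\<dots> = l"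
    using assms by (simp add: p_def)
  finally have "u*p + u*p \<le> u*p*x + p*y"
    using tan[of p "u*p"] p assms by simp
  then have "p*(2*u) \<le> p*(u*x + y)"
    by (simp add: algebra_simps)
  then have s: "2*u \<le> u*x + y"
    using p by simp
  then have "u*1 \<le> u*x"
    using assms by linarith
  then have "x = 1"
    using x1 assms by simp
  then have "y = u"
    using s assms by simp
  then show ?thesis
    using True \<open>x = 1\<close> by simp
next
  case False
  then obtain t X Y where t: "0 < t" "t \<le> 1"
    and eq: "x = 1 - t*(1 - X)" "y = u - t*(u - Y)" "z = u - t*(u - l)"
    using apex_projection_exists assms by (metis less_eq_real_def)
  note proj = apex_projection[OF eq]
  have "l \<le> X*Y \<and> 2*l \<le> u*X + Y"
  proof (rule tangent_lines_imp_hyperbola)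
    have "0 \<le> t*(u*X - Y)" "0 \<le> t*(1 + l - X - Y)"
      using assms by (simp_all flip: proj(3,4))
    then show "Y \<le> u*X" "X + Y \<le> 1 + l"
      using t by (simp_all add: zero_le_mult_iff)
    fix p q assume "0 < p" "p \<le> 1" "0 < q" "p*q = l" "q \<le> u*p"
    then have "0 \<le> (u - l)*(q*x + p*y) - (2*l*(u - z) + (z - l)*(q + u*p))"
      using tangent by simp
    also have "\<dots> = (u - l)*t*(q*X + p*Y - 2*l)"
      unfolding eq by (simp add: algebra_simps)
    finally have "0 \<le> (u - l)*t*(q*X + p*Y - 2*l)" .
    moreover have "0 < (u - l)*t"
      using t assms by simp
    ultimately have "0 \<le> q*X + p*Y - 2*l"
      by (simp only: zero_le_mult_iff) linarith
    then show "2*l \<le> q*X + p*Y"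
      by simp
  qed fact+
  then have "0 \<le> t\<^sup>2*(u - l)*(X*Y - l)" "0 \<le> u*x + y - 2*z"
    using t assms by (simp_all add: proj(2))
  then show ?thesis
    unfolding proj(1) by (intro real_le_lsqrt) auto
qed

lemma hull_tangent_plane:
  assumes "0 < l" "l < u" "vector [x, y, z] \<in> convex hull (F' l u)"
    and "0 < p" "0 < q" "p*q = l" "q \<le> u*p"
  shows "2*l*(u - z) + (z - l)*(q + u*p) \<le> (u - l)*(q*x + p*y)"
proof -
  have "2*l*u - l*(q + u*p) \<le> ((u - l)*q)*x + ((u - l)*p)*y + (2*l - (q + u*p))*z"
  proof (rule hull_halfspace[OF assms(3)])
    fix x y :: real assume "0 \<le> x" "x \<le> 1" "l \<le> x*y" "x*y \<le> u"
    then show "2*l*u - l*(q + u*p) \<le> ((u - l)*q)*x + ((u - l)*p)*y + (2*l - (q + u*p))*(x*y)"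
      using tangent_plane_valid[of l u x y p q] assms by (simp add: algebra_simps)
  qed
  then show ?thesis
    by (simp add: algebra_simps)
qed

lemma hull_bounds:
  assumes "vector [x, y, z] \<in> convex hull (F' l u)"
  shows "x + y - 1 \<le> z" "l \<le> z" "z \<le> u"
proof -
  have "-1 \<le> (-1)*x + (-1)*y + 1*z"
  proof (rule hull_halfspace[OF assms])
    fix x y :: real assume "x \<le> 1" "y \<le> 1"
    then have "0 \<le> (1 - x)*(1 - y)" by simp
    then show "-1 \<le> (-1)*x + (-1)*y + 1*(x*y)" by (simp add: algebra_simps)
  qed
  then show "x + y - 1 \<le> z" by simp
  have "l \<le> 0*x + 0*y + 1*z" by (rule hull_halfspace[OF assms]) auto
  then show "l \<le> z" by simp
  have "-u \<le> 0*x + 0*y + (-1)*z" by (rule hull_halfspace[OF assms]) auto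
  then show "z \<le> u" by simp
qed

section \<open>Validity of the middle cone on the hull\<close>

lemma middle_region_positive:
  fixes u x y :: real
  assumes "0 < u" "u < 1" "u*x \<le> y" "u*y \<le> x"
  shows "0 \<le> x"
proof -
  have "u*(u*x) \<le> x"
    using mult_left_mono[OF assms(3), of u] assms by linarith
  then have "0 \<le> (1 - u*u)*x"
    using assms by (simp add: algebra_simps)
  moreover have "u*u < 1"
    using mult_strict_mono[of u 1 u 1] assms by simp
  ultimately show ?thesis
    by (simp add: zero_le_mult_iff)
qed

text \<open>The tangent planes of the cone form a family indexed by \<open>p\<close>; each is valid
  on the hull, and a suitable \<open>p\<close> recovers the cone constraint.\<close>

lemma hull_middle_cone:
  assumes "0 < l" "l < u" "u < 1" "vector [x, y, z] \<in> convex hull (F' l u)"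
    and "u*x \<le> y" "u*y \<le> x"
  shows "(z + sqrt (l*u))\<^sup>2 \<le> (sqrt l + sqrt u)\<^sup>2 * (x*y)"
proof -
  define c where "c = sqrt l + sqrt u"
  have c: "0 < c"
    using assms by (simp add: c_def add_pos_pos)
  have plane: "2*(z + sqrt (l*u)) \<le> c*(p*x + y/p)" if "0 < p" for p
  proof -
    have "2 * sqrt (l*u) \<le> (c*p)*x + (c/p)*y + (-2)*z"
    proof (rule hull_halfspace[OF assms(4)])
      fix x y :: real assume xy: "0 \<le> x" "0 \<le> y" "l \<le> x*y" "x*y \<le> u"
      let ?r = "sqrt (x*y)"
      \<comment> \<open>\<open>?r\<close> lies between \<open>sqrt l\<close> and
        \<open>sqrt u\<close>, where the square of \<open>s\<close> is below its chord
        \<open>c*s - sqrt (l*u)\<close>.\<close>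
      have "(?r - sqrt l)*(?r - sqrt u) \<le> 0"
        using xy by (intro mult_nonneg_nonpos) auto
      then have "2*(x*y + sqrt (l*u)) \<le> c*(2*?r)"
        using xy by (simp add: c_def real_sqrt_mult algebra_simps)
      also have "\<dots> \<le> c*(p*x + y/p)"
        using weighted_AM_GM[of x y p] xy that c by (intro mult_left_mono) auto
      finally show "2 * sqrt (l*u) \<le> (c*p)*x + (c/p)*y + (-2)*(x*y)"
        by (simp add: algebra_simps)
    qed
    then show ?thesis
      by (simp add: algebra_simps)
  qed
  have z: "l \<le> z"
    using hull_bounds assms by blast
  have nonneg: "0 \<le> x" "0 \<le> y"
    using middle_region_positive[of u x y] middle_region_positive[of u y x] assms by auto
  have "x \<noteq> 0"
  proof
    assume "x = 0"
    then have "y = 0"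
      using assms nonneg by (simp add: mult_le_0_iff)
    then have "z + sqrt (l*u) \<le> 0"
      using plane[of 1] \<open>x = 0\<close> by simp
    moreover have "0 < sqrt (l*u)"
      using assms by simp
    ultimately show False
      using z assms by linarith
  qed
  moreover from this have "y \<noteq> 0"
    using assms nonneg by (auto simp: mult_le_0_iff)
  ultimately have pos: "0 < x" "0 < y"
    using nonneg by auto
  define r where "r = sqrt (x*y)"
  have r: "0 < r" "r*r = x*y"
    using pos by (auto simp: r_def)
  \<comment> \<open>\<open>p = r/x\<close> minimizes \<open>p*x + y/p\<close>: its plane touches the
    cone along the ray over \<open>(x, y)\<close>.\<close>
  have "r/x*x = r" "y/(r/x) = r"
    using pos r by (auto simp: field_simps)
  then have "z + sqrt (l*u) \<le> c*r"
    using plane[of "r/x"] pos r by simp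
  moreover have "0 \<le> z + sqrt (l*u)"
    using z assms by simp
  ultimately have "(z + sqrt (l*u))\<^sup>2 \<le> (c*r)\<^sup>2"
    by (rule power_mono)
  then show ?thesis
    using r(2) by (simp add: c_def power_mult_distrib power2_eq_square[of r])
qed

section \<open>The two inclusions, region by region\<close>

theorem proposition3:
  fixes l u :: real
  assumes "0 < l" and "l < u" and "u < 1"
  shows "pos_semidef (M1 l u) \<and> pos_semidef (M2 l u) \<and>
    convex hull (F' l u) =
      {vector [x, y, z] | x y z.
         z \<ge> x + y - 1 \<and> l \<le> z \<and> z \<le> u \<and>
         (y \<ge> u * x \<and> x \<ge> u * y \<longrightarrow>
            (z + sqrt (l * u))\<^sup>2 \<le> (sqrt l + sqrt u)\<^sup>2 * (x * y)) \<and>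
         (y \<le> u * x \<longrightarrow>
            (let v = (vector [1 - x, u - y] :: real^2)
             in sqrt (v \<bullet> (M1 l u *v v)) \<le> u * x + y - 2 * z)) \<and>
         (x \<le> u * y \<longrightarrow>
            (let v = (vector [u - x, 1 - y] :: real^2)
             in sqrt (v \<bullet> (M2 l u *v v)) \<le> x + u * y - 2 * z))}"
proof -
  let ?S = "{vector [x, y, z] :: real^3 | x y z.
         z \<ge> x + y - 1 \<and> l \<le> z \<and> z \<le> u \<and>
         (y \<ge> u * x \<and> x \<ge> u * y \<longrightarrow>
            (z + sqrt (l * u))\<^sup>2 \<le> (sqrt l + sqrt u)\<^sup>2 * (x * y)) \<and>
         (y \<le> u * x \<longrightarrow>
            (let v = (vector [1 - x, u - y] :: real^2)
             in sqrt (v \<bullet> (M1 l u *v v)) \<le> u * x + y - 2 * z)) \<and>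
         (x \<le> u * y \<longrightarrow>
            (let v = (vector [u - x, 1 - y] :: real^2)
             in sqrt (v \<bullet> (M2 l u *v v)) \<le> x + u * y - 2 * z))}"
  have "v \<in> ?S" if v: "v \<in> convex hull (F' l u)" for v
  proof -
    define x y z where "x = v$1" and "y = v$2" and "z = v$3"
    have xyz: "v = vector [x, y, z]"
      by (simp add: x_def y_def z_def vector3_eta)
    have h: "vector [x, y, z] \<in> convex hull (F' l u)"
      using v xyz by simp
    note swapped = hull_swap[OF h]
    have "sqrt ((u*(1 - x) + (u - y))\<^sup>2 - 4*(u - l)*((1 - x)*(u - y))) \<le> u*x + y - 2*z"
      if "y \<le> u*x"
      using corner_cone_of_tangent_planes assms hull_bounds[OF h] that
        hull_tangent_plane[OF assms(1,2) h] by blast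
    moreover
    have "sqrt ((u*(1 - y) + (u - x))\<^sup>2 - 4*(u - l)*((1 - y)*(u - x))) \<le> u*y + x - 2*z"
      if "x \<le> u*y"
      using corner_cone_of_tangent_planes assms hull_bounds[OF swapped] that
        hull_tangent_plane[OF assms(1,2) swapped] by blast
    ultimately show ?thesis
      using hull_bounds[OF h] hull_middle_cone[OF assms h]
      unfolding xyz Let_def quadform_M1 quadform_M2
      by (intro CollectI exI[of _ x] exI[of _ y] exI[of _ z]) (simp add: add.commute)
  qed
  moreover have "v \<in> convex hull (F' l u)" if v: "v \<in> ?S" for v
  proof -
    obtain x y z where xyz: "v = vector [x, y, z]"
      and bounds: "x + y - 1 \<le> z" "l \<le> z" "z \<le> u"
      and middle: "u*x \<le> y \<Longrightarrow> u*y \<le> x \<Longrightarrow>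
        (z + sqrt (l*u))\<^sup>2 \<le> (sqrt l + sqrt u)\<^sup>2 * (x*y)"
      and corner1: "y \<le> u*x \<Longrightarrow>
        sqrt ((u*(1 - x) + (u - y))\<^sup>2 - 4*(u - l)*((1 - x)*(u - y))) \<le> u*x + y - 2*z"
      and corner2: "x \<le> u*y \<Longrightarrow>
        sqrt ((u*(1 - y) + (u - x))\<^sup>2 - 4*(u - l)*((1 - y)*(u - x))) \<le> x + u*y - 2*z"
      using v unfolding Let_def quadform_M1 quadform_M2 by blast
    consider "y \<le> u*x" | "x \<le> u*y" | "u*x \<le> y" "u*y \<le> x"
      by linarith
    then show ?thesis
    proof cases
      case 1
      then show ?thesis
        unfolding xyz using assms bounds corner1 by (intro hull_corner_region) auto
    next
      case 2
      then have "vector [y, x, z] \<in> convex hull (F' l u)"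
        using assms bounds corner2 by (intro hull_corner_region) (auto simp: add.commute)
      then show ?thesis
        unfolding xyz by (rule hull_swap)
    next
      case 3
      \<comment> \<open>A positive left side of the cone constraint excludes \<open>x*y = 0\<close>,
        so the weak signs of \<open>x\<close> and \<open>y\<close> become strict.\<close>
      have "0 < (z + sqrt (l*u))\<^sup>2"
        using assms bounds by (intro zero_less_power add_pos_pos) auto
      then have "x*y \<noteq> 0"
        using middle[OF 3] by auto
      then have "0 < x" "0 < y"
        using middle_region_positive[of u x y] middle_region_positive[of u y x] 3 assms
        by (auto simp: less_le)
      then show ?thesis
        unfolding xyz using 3 assms bounds middle by (intro hull_middle_region) auto
    qed
  qed
  ultimately have "convex hull (F' l u) = ?S"
    by blast
  then show ?thesis
    using pos_semidef_M1 pos_semidef_M2 assms by blast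
qed

end
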